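(* Let $G$ be a group, $F$ a field, and let $R$ and $R'$ be the algebras of finitary matrices over $F$ (indexed by $I$) endowed with two elementary gradings $R=\bigoplus_{g\in G}R^{(g)}$ and $R'=\bigoplus_{g\in G}(R')^{(g)}$ defined by functions $\tau:I\to G$ and $\tau':I\to G$, respectively. Then $R$ and $R'$ are isomorphic as graded algebras if and only if there is an element $g_0\in G$ such that $S_\tau(g)=S_{\tau'}(g_0g)$ for all $g\in G$.
   Context: Here $I$ is the set $\{1,2,3,\ldots\}$ or a nonempty initial segment $\{1,\ldots,n\}$ of it. The algebra of finitary matrices indexed by $I$ is the algebra of $I\times I$ matrices over $F$ with only finitely many nonzero entries (it is $M_n(F)$ when $I=\{1,\ldots,n\}$), with basis the matrix units $E_{ij}$, $i,j\in I$. The elementary $G$-grading defined by $\tau:I\to G$, $\tau(i)=g_i$, is the grading whose component of degree $g$ is $\mathrm{Span}\{E_{ij}\mid g_i^{-1}g_j=g\}$. The function $S_\tau:G\to\{0,1,2,\ldots\}\cup\{\infty\}$ is defined by $S_\tau(g)=\mathrm{Card}(\tau^{-1}(g))$, and similarly for $S_{\tau'}$. Two $G$-graded algebras $R$ and $R'$ are isomorphic as graded algebras if there is an algebra isomorphism $f:R\to R'$ with $f(R^{(g)})=(R')^{(g)}$ for all $g\in G$. *)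

theory Defs
  imports "HOL-Algebra.Group" "HOL-Library.Function_Algebras"
    "HOL-Library.Groups_Big_Fun" "HOL-Library.Extended_Nat"
begin

text \<open>
  Matrices are functions of two indices. Addition, zero and negation are the pointwise operations
  of \<^theory>\<open>HOL-Library.Function_Algebras\<close>; the pointwise product of that theory is \<^emph>\<open>not\<close> the
  matrix product and is not used.
\<close>

type_synonym 'f matrix = "nat \<Rightarrow> nat \<Rightarrow> 'f"

definition mscale :: "'f::field \<Rightarrow> 'f matrix \<Rightarrow> 'f matrix" where
  "mscale c A = (\<lambda>i j. c * A i j)"

text \<open>\<^const>\<open>Sum_any\<close> sums over the indices with nonzero summand, so it is the genuine sum
  whenever \<open>A\<close> and \<open>B\<close> are finitary, even if the index set is infinite.\<close>

definition mmult :: "'f::field matrix \<Rightarrow> 'f matrix \<Rightarrow> 'f matrix" where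
  "mmult A B = (\<lambda>i j. Sum_any (\<lambda>k. A i k * B k j))"

definition munit :: "nat \<Rightarrow> nat \<Rightarrow> 'f::field matrix" where
  "munit i j = (\<lambda>k l. if k = i \<and> l = j then 1 else 0)"

interpretation mat: vector_space "mscale :: 'f::field \<Rightarrow> 'f matrix \<Rightarrow> 'f matrix"
  by unfold_locales (auto simp: mscale_def fun_eq_iff algebra_simps)

text \<open>An \<open>I \<times> I\<close> matrix is represented by its extension by zero to all pairs of naturals.\<close>

definition finitary_matrices :: "nat set \<Rightarrow> 'f::field matrix set" where
  "finitary_matrices I =
    {A. finite {(i, j). A i j \<noteq> 0} \<and> (\<forall>i j. A i j \<noteq> 0 \<longrightarrow> i \<in> I \<and> j \<in> I)}"

definition elementary_grading ::
    "('g, 'm) monoid_scheme \<Rightarrow> nat set \<Rightarrow> (nat \<Rightarrow> 'g) \<Rightarrow> 'g \<Rightarrow> 'f::field matrix set" where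
  "elementary_grading G I \<tau> g =
    mat.span {munit i j | i j. i \<in> I \<and> j \<in> I \<and> inv\<^bsub>G\<^esub> (\<tau> i) \<otimes>\<^bsub>G\<^esub> \<tau> j = g}"

text \<open>No condition on a unit is imposed: for infinite \<open>I\<close> there is none, and for finite \<open>I\<close> a
  bijective multiplicative map preserves it automatically.\<close>

definition algebra_isomorphism ::
    "nat set \<Rightarrow> ('f::field matrix \<Rightarrow> 'f matrix) \<Rightarrow> bool" where
  "algebra_isomorphism I f \<longleftrightarrow>
    bij_betw f (finitary_matrices I) (finitary_matrices I) \<and>
    (\<forall>A\<in>finitary_matrices I. \<forall>B\<in>finitary_matrices I. f (A + B) = f A + f B) \<and>
    (\<forall>c. \<forall>A\<in>finitary_matrices I. f (mscale c A) = mscale c (f A)) \<and>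
    (\<forall>A\<in>finitary_matrices I. \<forall>B\<in>finitary_matrices I. f (mmult A B) = mmult (f A) (f B))"

text \<open>The arguments \<open>R\<close> and \<open>R'\<close> are the families of homogeneous components of two gradings of the
  algebra of finitary matrices indexed by \<open>I\<close>.\<close>

definition graded_isomorphic ::
    "('g, 'm) monoid_scheme \<Rightarrow> nat set \<Rightarrow> ('g \<Rightarrow> 'f::field matrix set) \<Rightarrow> ('g \<Rightarrow> 'f matrix set) \<Rightarrow> bool"
  where
  "graded_isomorphic G I R R' \<longleftrightarrow>
    (\<exists>f. algebra_isomorphism I f \<and> (\<forall>g\<in>carrier G. f ` R g = R' g))"

definition fibre_card :: "nat set \<Rightarrow> (nat \<Rightarrow> 'g) \<Rightarrow> 'g \<Rightarrow> enat" where
  "fibre_card I \<tau> g =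
    (if finite {i \<in> I. \<tau> i = g} then enat (card {i \<in> I. \<tau> i = g}) else \<infinity>)"

end

theory Submission
  imports Defs
begin

text \<open>
  If the fibres have equal size up to translation, a bijection \<open>\<pi>\<close> of \<open>I\<close> with
  \<open>\<tau>' (\<pi> i) = g\<^sub>0 \<tau> i\<close> exists, and permuting rows and columns along \<open>\<pi>\<close> is a graded isomorphism.

  Conversely, let \<open>f\<close> be a graded isomorphism, \<open>l \<in> I\<close> and \<open>Q = f\<^sup>-\<^sup>1 E\<^sub>l\<^sub>l\<close>, with a nonzero entry at
  \<open>(a, m)\<close>. The matrices \<open>f (E\<^sub>i\<^sub>a) E\<^sub>l\<^sub>l = f (E\<^sub>i\<^sub>a Q)\<close> with \<open>\<tau> i = g\<close> are linearly independent, because the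
  \<open>E\<^sub>i\<^sub>a Q\<close> are, and by homogeneity they lie in the span of the \<open>E\<^sub>k\<^sub>l\<close> with
  \<open>\<tau>' k = \<tau>' l (\<tau> a)\<^sup>-\<^sup>1 g\<close>. Hence \<open>S\<^sub>\<tau>(g) \<le> S\<^sub>\<tau>\<^sub>'(\<tau>' l (\<tau> a)\<^sup>-\<^sup>1 g)\<close>. Now \<open>Q E\<^sub>m\<^sub>m \<noteq> 0\<close>, so \<open>f (E\<^sub>m\<^sub>m)\<close> has a
  nonzero entry in row \<open>l\<close>, and \<open>\<tau> m = \<tau> a\<close> because \<open>Q\<close> has degree one; so the same argument for
  \<open>f\<^sup>-\<^sup>1\<close> yields the reverse inequality with the inverse translation.
\<close>

section \<open>Matrix units and the algebra of finitary matrices\<close>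

lemma mmult_munit_right: "mmult A (munit a b) i j = (if j = b then A i a else 0)"
proof -
  have "mmult A (munit a b) i j = (\<Sum>k\<in>{a}. A i k * munit a b k j)"
    unfolding mmult_def by (rule Sum_any.expand_superset) (auto simp: munit_def)
  then show ?thesis by (simp add: munit_def)
qed

lemma mmult_munit_left: "mmult (munit a b) B i j = (if i = a then B b j else 0)"
proof -
  have "mmult (munit a b) B i j = (\<Sum>k\<in>{b}. munit a b i k * B k j)"
    unfolding mmult_def by (rule Sum_any.expand_superset) (auto simp: munit_def)
  then show ?thesis by (simp add: munit_def)
qed

lemma finitary_munit:
  assumes "i \<in> I" "j \<in> I"
  shows "munit i j \<in> (finitary_matrices I :: 'f::field matrix set)"
proof -
  have "{(k, l). munit i j k l \<noteq> (0::'f)} \<subseteq> {(i, j)}" by (auto simp: munit_def)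
  then have "finite {(k, l). munit i j k l \<noteq> (0::'f)}" by (rule finite_subset) simp
  with assms show ?thesis by (auto simp: finitary_matrices_def munit_def)
qed

lemma subspace_finitary: "mat.subspace (finitary_matrices I :: 'f::field matrix set)"
proof (rule mat.subspaceI)
  show "0 \<in> finitary_matrices I" by (simp add: finitary_matrices_def)
next
  fix A B :: "'f matrix"
  assume A: "A \<in> finitary_matrices I" and B: "B \<in> finitary_matrices I"
  have "{(i, j). (A + B) i j \<noteq> 0} \<subseteq> {(i, j). A i j \<noteq> 0} \<union> {(i, j). B i j \<noteq> 0}" by auto
  moreover have "finite \<dots>" using A B by (simp add: finitary_matrices_def)
  ultimately have "finite {(i, j). (A + B) i j \<noteq> 0}" by (rule finite_subset)
  moreover have "i \<in> I \<and> j \<in> I" if "(A + B) i j \<noteq> 0" for i j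
  proof -
    have "A i j \<noteq> 0 \<or> B i j \<noteq> 0" using that by auto
    then show ?thesis using A B by (auto simp: finitary_matrices_def)
  qed
  ultimately show "A + B \<in> finitary_matrices I" by (simp add: finitary_matrices_def)
next
  fix c and A :: "'f matrix"
  assume A: "A \<in> finitary_matrices I"
  have "{(i, j). mscale c A i j \<noteq> 0} \<subseteq> {(i, j). A i j \<noteq> 0}" by (auto simp: mscale_def)
  then have "finite {(i, j). mscale c A i j \<noteq> 0}"
    using A by (auto simp: finitary_matrices_def intro: finite_subset)
  with A show "mscale c A \<in> finitary_matrices I" by (auto simp: finitary_matrices_def mscale_def)
qed

lemma finitary_mmult:
  assumes A: "A \<in> finitary_matrices I" and B: "B \<in> finitary_matrices I"
  shows "mmult A B \<in> finitary_matrices I"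
proof -
  have nz: "\<exists>k. A i k \<noteq> 0 \<and> B k j \<noteq> 0" if "mmult A B i j \<noteq> 0" for i j
  proof (rule ccontr)
    assume "\<nexists>k. A i k \<noteq> 0 \<and> B k j \<noteq> 0"
    then have "A i k * B k j = 0" for k by auto
    with that show False by (simp add: mmult_def)
  qed
  \<comment> \<open>A nonzero entry of the product comes from a nonzero summand, so the support lies
    in the nonzero rows of \<open>A\<close> times the nonzero columns of \<open>B\<close>.\<close>
  have "{(i, j). mmult A B i j \<noteq> 0}
      \<subseteq> fst ` {(i, j). A i j \<noteq> 0} \<times> snd ` {(i, j). B i j \<noteq> 0}"
    using nz by force
  moreover have "finite \<dots>" using A B by (simp add: finitary_matrices_def)
  ultimately have "finite {(i, j). mmult A B i j \<noteq> 0}" by (rule finite_subset)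
  moreover have "i \<in> I \<and> j \<in> I" if "mmult A B i j \<noteq> 0" for i j
    using nz[OF that] A B by (auto simp: finitary_matrices_def)
  ultimately show ?thesis by (simp add: finitary_matrices_def)
qed

lemma sum_matrix_apply: "(\<Sum>x\<in>S. F x) i j = (\<Sum>x\<in>S. F x i j)" for F :: "'a \<Rightarrow> 'f::field matrix"
  by (induction S rule: infinite_finite_induct) auto

section \<open>Homogeneous components described by supports\<close>

lemma in_span_munit:
  assumes fin: "finite {(i, j). A i j \<noteq> 0}"
    and supp: "\<And>i j. A i j \<noteq> 0 \<Longrightarrow> munit i j \<in> S"
  shows "A \<in> mat.span S"
proof -
  let ?D = "{(i, j). A i j \<noteq> 0}"
  have "A = (\<Sum>p\<in>?D. mscale (A (fst p) (snd p)) (munit (fst p) (snd p)))"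
  proof (intro ext)
    fix i j
    have "(\<Sum>p\<in>?D. mscale (A (fst p) (snd p)) (munit (fst p) (snd p)) i j)
        = (\<Sum>p\<in>?D. if p = (i, j) then A i j else 0)"
      by (rule sum.cong) (auto simp: mscale_def munit_def)
    also have "\<dots> = A i j" using fin by (simp add: sum.delta)
    finally show "A i j = (\<Sum>p\<in>?D. mscale (A (fst p) (snd p)) (munit (fst p) (snd p))) i j"
      by (simp add: sum_matrix_apply)
  qed
  also have "\<dots> \<in> mat.span S"
    by (intro mat.span_sum mat.span_scale mat.span_base) (auto intro: supp)
  finally show ?thesis .
qed

text \<open>Finitary matrices supported on positions of degree \<open>g\<close> form a subspace
  containing the generating units, which bounds the span from above; the expansion into entries
  gives the other inclusion. Homogeneity is thus checked entry by entry from here on.\<close>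

lemma elementary_grading_iff:
  "A \<in> elementary_grading G I \<tau> g \<longleftrightarrow>
    A \<in> finitary_matrices I \<and> (\<forall>i j. A i j \<noteq> 0 \<longrightarrow> inv\<^bsub>G\<^esub> (\<tau> i) \<otimes>\<^bsub>G\<^esub> \<tau> j = g)"
    (is "?L \<longleftrightarrow> ?R")
proof
  assume ?L
  let ?T = "{A. \<forall>i j. A i j \<noteq> (0::'a) \<longrightarrow> inv\<^bsub>G\<^esub> (\<tau> i) \<otimes>\<^bsub>G\<^esub> \<tau> j = g}"
  have "mat.subspace ?T"
    by (rule mat.subspaceI) (auto simp: mscale_def, metis add_0)
  then have "mat.subspace (finitary_matrices I \<inter> ?T)"
    by (intro mat.subspace_inter subspace_finitary)
  then have "mat.span {munit i j | i j. i \<in> I \<and> j \<in> I \<and> inv\<^bsub>G\<^esub> (\<tau> i) \<otimes>\<^bsub>G\<^esub> \<tau> j = g}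
      \<subseteq> finitary_matrices I \<inter> ?T"
    by (intro mat.span_minimal) (auto intro!: finitary_munit, auto simp: munit_def split: if_splits)
  with \<open>?L\<close> show ?R by (auto simp: elementary_grading_def)
next
  assume ?R
  then show ?L
    unfolding elementary_grading_def
  proof (intro in_span_munit)
    show "finite {(i, j). A i j \<noteq> 0}" using \<open>?R\<close> by (simp add: finitary_matrices_def)
  next
    fix i j assume "A i j \<noteq> 0"
    with \<open>?R\<close> have "i \<in> I \<and> j \<in> I \<and> inv\<^bsub>G\<^esub> (\<tau> i) \<otimes>\<^bsub>G\<^esub> \<tau> j = g"
      by (simp add: finitary_matrices_def)
    then show "munit i j \<in> {munit i j | i j. i \<in> I \<and> j \<in> I \<and> inv\<^bsub>G\<^esub> (\<tau> i) \<otimes>\<^bsub>G\<^esub> \<tau> j = g}"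
      by blast
  qed
qed

section \<open>Algebra isomorphisms and their inverses\<close>

lemma algebra_isomorphismD:
  assumes "algebra_isomorphism I f"
  shows "bij_betw f (finitary_matrices I) (finitary_matrices I)"
    and "A \<in> finitary_matrices I \<Longrightarrow> B \<in> finitary_matrices I \<Longrightarrow> f (A + B) = f A + f B"
    and "A \<in> finitary_matrices I \<Longrightarrow> f (mscale c A) = mscale c (f A)"
    and "A \<in> finitary_matrices I \<Longrightarrow> B \<in> finitary_matrices I \<Longrightarrow> f (mmult A B) = mmult (f A) (f B)"
  using assms by (auto simp: algebra_isomorphism_def)

lemma algebra_isomorphism_zero:
  assumes "algebra_isomorphism I f"
  shows "f 0 = 0"
  using algebra_isomorphismD(3)[OF assms, of 0 0] by (simp add: mat.subspace_0[OF subspace_finitary])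

lemma algebra_isomorphism_sum:
  assumes f: "algebra_isomorphism I f" and "finite S"
    and "\<And>x. x \<in> S \<Longrightarrow> A x \<in> finitary_matrices I"
  shows "f (\<Sum>x\<in>S. mscale (c x) (A x)) = (\<Sum>x\<in>S. mscale (c x) (f (A x)))"
  using assms(2,3)
proof (induction S rule: finite_induct)
  case empty
  show ?case by (simp only: sum.empty algebra_isomorphism_zero[OF f])
next
  case (insert x S)
  have "mscale (c x) (A x) \<in> finitary_matrices I"
    using insert by (intro mat.subspace_scale[OF subspace_finitary]) auto
  moreover have "(\<Sum>x\<in>S. mscale (c x) (A x)) \<in> finitary_matrices I"
    using insert by (intro mat.subspace_sum[OF subspace_finitary] mat.subspace_scale[OF subspace_finitary]) auto
  moreover have "f (mscale (c x) (A x)) = mscale (c x) (f (A x))"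
    using insert by (intro algebra_isomorphismD(3)[OF f]) auto
  moreover have "f (\<Sum>x\<in>S. mscale (c x) (A x)) = (\<Sum>x\<in>S. mscale (c x) (f (A x)))"
    using insert by auto
  ultimately show ?case
    by (simp only: sum.insert[OF insert(1,2)] algebra_isomorphismD(2)[OF f])
qed

lemma algebra_isomorphism_inv:
  assumes f: "algebra_isomorphism I f"
  shows "algebra_isomorphism I (inv_into (finitary_matrices I) f)"
proof -
  let ?M = "finitary_matrices I :: 'a matrix set"
  let ?h = "inv_into ?M f"
  note bij = algebra_isomorphismD(1)[OF f]
  have h: "?h A \<in> ?M" "f (?h A) = A" if "A \<in> ?M" for A
    using that bij by (auto simp: bij_betw_def inv_into_into f_inv_into_f)
  \<comment> \<open>Reduces each law for \<open>?h\<close> to checking that \<open>f\<close> sends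
    the claimed value to the argument of \<open>?h\<close>.\<close>
  have eq: "?h B = A" if "A \<in> ?M" "f A = B" for A B
    using that bij by (auto simp: bij_betw_def)
  show ?thesis
    unfolding algebra_isomorphism_def
  proof (intro conjI ballI allI)
    show "bij_betw ?h ?M ?M" using bij by (rule bij_betw_inv_into)
  next
    fix A B assume "A \<in> ?M" "B \<in> ?M"
    then show "?h (A + B) = ?h A + ?h B"
      by (intro eq mat.subspace_add[OF subspace_finitary]) (simp_all add: h algebra_isomorphismD(2)[OF f])
  next
    fix c A assume "A \<in> ?M"
    then show "?h (mscale c A) = mscale c (?h A)"
      by (intro eq mat.subspace_scale[OF subspace_finitary]) (simp_all add: h algebra_isomorphismD(3)[OF f])
  next
    fix A B assume "A \<in> ?M" "B \<in> ?M"
    then show "?h (mmult A B) = mmult (?h A) (?h B)"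
      by (intro eq finitary_mmult) (simp_all add: h algebra_isomorphismD(4)[OF f])
  qed
qed

section \<open>From a graded isomorphism to equal fibre sizes\<close>

text \<open>An independent family indexed by \<open>J\<close> lies in the span of a family indexed
  by the target fibre. A finite \<open>J\<close> inside the source fibre, rather than the fibre
  itself, also lets the bound apply when that fibre might be infinite.\<close>

lemma (in group) card_fibre_le:
  assumes \<tau>: "\<tau> \<in> I \<rightarrow> carrier G" and \<tau>': "\<tau>' \<in> I \<rightarrow> carrier G"
    and f: "algebra_isomorphism I f"
    and graded: "\<And>g. g \<in> carrier G \<Longrightarrow> f ` elementary_grading G I \<tau> g \<subseteq> elementary_grading G I \<tau>' g"
    and Q: "Q \<in> finitary_matrices I" "f Q = munit l l" "Q a m \<noteq> (0::'f::field)"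
    and l: "l \<in> I" and g: "g \<in> carrier G"
    and J: "finite J" "J \<subseteq> {i \<in> I. \<tau> i = g}"
    and K: "finite {k \<in> I. \<tau>' k = \<tau>' l \<otimes> inv (\<tau> a) \<otimes> g}"
  shows "card J \<le> card {k \<in> I. \<tau>' k = \<tau>' l \<otimes> inv (\<tau> a) \<otimes> g}"
proof -
  let ?K = "{k \<in> I. \<tau>' k = \<tau>' l \<otimes> inv (\<tau> a) \<otimes> g}"
  let ?M = "finitary_matrices I :: 'f matrix set"
  \<comment> \<open>\<open>W i\<close> carries row \<open>a\<close> of \<open>Q\<close> in row
    \<open>i\<close> and is zero elsewhere. Column \<open>m\<close>, where that row is nonzero,
    therefore separates the \<open>W i\<close>.\<close>
  define W where "W i = mmult (munit i a) Q" for i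
  have a: "a \<in> I" using Q by (auto simp: finitary_matrices_def)
  have JI: "J \<subseteq> I" using J by auto
  have W: "W i \<in> ?M" if "i \<in> J" for i
    unfolding W_def using that JI a Q by (intro finitary_mmult finitary_munit) auto
  have W_apply: "W i r m = (if r = i then Q a m else 0)" for i r
    by (simp add: W_def mmult_munit_left)
  have inj_f: "inj_on f ?M" using algebra_isomorphismD(1)[OF f] by (simp add: bij_betw_def)
  have inj_W: "inj_on W J"
    using W_apply Q(3) by (metis inj_onI)
  have inj: "inj_on (f \<circ> W) J"
    using inj_W by (rule comp_inj_on) (use W in \<open>auto intro: inj_on_subset[OF inj_f]\<close>)
  have ind: "mat.independent ((f \<circ> W) ` J)"
  proof (rule mat.independent_if_scalars_zero)
    show "finite ((f \<circ> W) ` J)" using J by simp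
  next
    fix u x assume sum0: "(\<Sum>x\<in>(f \<circ> W) ` J. mscale (u x) x) = 0" and x: "x \<in> (f \<circ> W) ` J"
    from x obtain i where i: "i \<in> J" "x = f (W i)" by auto
    \<comment> \<open>Injectivity of \<open>f \<circ> W\<close> turns the relation over the image
      into one over \<open>J\<close>; injectivity of \<open>f\<close> then pulls it back to the
      \<open>W j\<close>, where entry \<open>(i, m)\<close> isolates the coefficient of
      \<open>W i\<close>.\<close>
    let ?c = "\<lambda>j. u (f (W j))"
    have "f (\<Sum>j\<in>J. mscale (?c j) (W j)) = (\<Sum>j\<in>J. mscale (?c j) (f (W j)))"
      using J W by (intro algebra_isomorphism_sum[OF f]) auto
    also have "\<dots> = f 0"
      using sum0 sum.reindex[OF inj, of "\<lambda>x. mscale (u x) x"] algebra_isomorphism_zero[OF f]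
      by (simp add: o_def)
    finally have "(\<Sum>j\<in>J. mscale (?c j) (W j)) = 0"
      by (rule inj_onD[OF inj_f])
        (auto intro!: mat.subspace_sum mat.subspace_scale mat.subspace_0 subspace_finitary W)
    then have "0 = (\<Sum>j\<in>J. mscale (?c j) (W j)) i m" by simp
    also have "\<dots> = (\<Sum>j\<in>J. if j = i then ?c i * Q a m else 0)"
      by (auto simp: sum_matrix_apply mscale_def W_apply intro!: sum.cong)
    also have "\<dots> = ?c i * Q a m" using i J by (simp add: sum.delta)
    finally show "u x = 0" using Q(3) i by simp
  qed
  have "(f \<circ> W) ` J \<subseteq> mat.span ((\<lambda>k. munit k l) ` ?K)"
  proof (clarsimp)
    fix i assume "i \<in> J"
    then have i: "i \<in> I" "\<tau> i = g" using J by auto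
    \<comment> \<open>This is the degree of \<open>munit i a\<close>, since \<tau> i = g.\<close>
    have "inv g \<otimes> \<tau> a \<in> carrier G" using \<tau> a g by auto
    moreover have "munit i a \<in> elementary_grading G I \<tau> (inv g \<otimes> \<tau> a)"
      using i a by (auto simp: elementary_grading_def intro!: mat.span_base)
    ultimately have "f (munit i a) \<in> elementary_grading G I \<tau>' (inv g \<otimes> \<tau> a)"
      using graded by blast
    then have E: "f (munit i a) \<in> ?M"
      "\<And>r s. f (munit i a) r s \<noteq> 0 \<Longrightarrow> inv (\<tau>' r) \<otimes> \<tau>' s = inv g \<otimes> \<tau> a"
      by (auto simp: elementary_grading_iff)
    \<comment> \<open>As \<open>f Q = munit l l\<close>, only column \<open>l\<close> of
      \<open>f (munit i a)\<close> survives.\<close>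
    have fW: "f (W i) = mmult (f (munit i a)) (munit l l)"
      using i a Q by (simp add: W_def algebra_isomorphismD(4)[OF f] finitary_munit)
    show "f (W i) \<in> mat.span ((\<lambda>k. munit k l) ` ?K)"
    proof (rule in_span_munit)
      show "finite {(r, s). f (W i) r s \<noteq> 0}"
        using finitary_mmult[OF E(1) finitary_munit[OF l l]] by (simp add: fW finitary_matrices_def)
    next
      fix r s assume "f (W i) r s \<noteq> 0"
      then have s: "s = l" "f (munit i a) r l \<noteq> 0"
        by (auto simp: fW mmult_munit_right split: if_splits)
      then have r: "r \<in> I" using E(1) by (auto simp: finitary_matrices_def)
      have c: "\<tau>' r \<in> carrier G" "\<tau>' l \<in> carrier G" "\<tau> a \<in> carrier G"
        using \<tau> \<tau>' r l a by auto
      \<comment> \<open>The degree equation at position \<open>(r, l)\<close> is solved for \<tau>'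
        r, which places \<open>r\<close> in the target fibre.\<close>
      have "\<tau>' r \<otimes> (inv g \<otimes> \<tau> a) = \<tau>' l"
        using E(2)[OF s(2)] c g by (metis inv_closed inv_solve_left m_closed)
      then have "\<tau>' l \<otimes> inv (\<tau> a) \<otimes> g = \<tau>' r \<otimes> (inv g \<otimes> \<tau> a) \<otimes> inv (\<tau> a) \<otimes> g" by simp
      also have "\<dots> = \<tau>' r" using c g by (simp add: m_assoc inv_solve_right')
      finally show "munit r s \<in> (\<lambda>k. munit k l) ` ?K" using r s by auto
    qed
  qed
  then have "card ((f \<circ> W) ` J) \<le> card ((\<lambda>k. munit k l :: 'f matrix) ` ?K)"
    using mat.independent_span_bound[OF _ ind] K by blast
  also have "\<dots> \<le> card ?K" using K by (rule card_image_le)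
  finally show ?thesis using card_image[OF inj] by simp
qed

text \<open>An infinite target fibre makes the bound trivial. A finite one bounds every finite
  subset of the source fibre, which is therefore finite as well.\<close>

lemma (in group) fibre_card_le:
  assumes \<tau>: "\<tau> \<in> I \<rightarrow> carrier G" and \<tau>': "\<tau>' \<in> I \<rightarrow> carrier G"
    and f: "algebra_isomorphism I f"
    and graded: "\<And>g. g \<in> carrier G \<Longrightarrow> f ` elementary_grading G I \<tau> g \<subseteq> elementary_grading G I \<tau>' g"
    and Q: "Q \<in> finitary_matrices I" "f Q = munit l l" "Q a m \<noteq> (0::'f::field)"
    and l: "l \<in> I" and g: "g \<in> carrier G"
  shows "fibre_card I \<tau> g \<le> fibre_card I \<tau>' (\<tau>' l \<otimes> inv (\<tau> a) \<otimes> g)"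
proof (cases "finite {k \<in> I. \<tau>' k = \<tau>' l \<otimes> inv (\<tau> a) \<otimes> g}")
  case True
  note le = card_fibre_le[OF \<tau> \<tau>' f graded Q l g _ _ True]
  have "finite {i \<in> I. \<tau> i = g}"
  proof (rule ccontr)
    assume "infinite {i \<in> I. \<tau> i = g}"
    then obtain J where "finite J" "J \<subseteq> {i \<in> I. \<tau> i = g}"
      "card J = Suc (card {k \<in> I. \<tau>' k = \<tau>' l \<otimes> inv (\<tau> a) \<otimes> g})"
      by (meson infinite_arbitrarily_large)
    then show False using le[of J] by simp
  qed
  then show ?thesis using True le[of "{i \<in> I. \<tau> i = g}"] by (simp add: fibre_card_def)
qed (simp add: fibre_card_def)

lemma (in group) graded_isomorphic_imp_fibre_card:
  assumes \<tau>: "\<tau> \<in> I \<rightarrow> carrier G" and \<tau>': "\<tau>' \<in> I \<rightarrow> carrier G"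
    and iso: "graded_isomorphic G I (elementary_grading G I \<tau> :: 'a \<Rightarrow> 'f::field matrix set)
      (elementary_grading G I \<tau>')"
    and "I \<noteq> {}"
  shows "\<exists>g\<^sub>0\<in>carrier G. \<forall>g\<in>carrier G. fibre_card I \<tau> g = fibre_card I \<tau>' (g\<^sub>0 \<otimes> g)"
proof -
  let ?M = "finitary_matrices I :: 'f matrix set"
  from iso obtain f :: "'f matrix \<Rightarrow> 'f matrix" where f: "algebra_isomorphism I f"
    and graded: "\<And>g. g \<in> carrier G \<Longrightarrow> f ` elementary_grading G I \<tau> g = elementary_grading G I \<tau>' g"
    by (auto simp: graded_isomorphic_def)
  define h where "h = inv_into ?M f"
  have bij: "bij_betw f ?M ?M" by (rule algebra_isomorphismD(1)[OF f])
  have h_iso: "algebra_isomorphism I h"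
    unfolding h_def using f by (rule algebra_isomorphism_inv)
  have hf: "h (f A) = A" if "A \<in> ?M" for A
    using that bij by (simp add: h_def bij_betw_def)
  have sub: "elementary_grading G I \<tau> g \<subseteq> ?M" for g by (auto simp: elementary_grading_iff)
  have h_graded: "h ` elementary_grading G I \<tau>' g = elementary_grading G I \<tau> g"
    if "g \<in> carrier G" for g
    unfolding graded[OF that, symmetric] image_image using hf sub by force
  obtain l where l: "l \<in> I" using \<open>I \<noteq> {}\<close> by auto
  have tl: "\<tau>' l \<in> carrier G" using \<tau>' l by auto
  have "munit l l \<in> elementary_grading G I \<tau>' \<one>"
    using l tl by (auto simp: elementary_grading_iff finitary_munit) (simp add: munit_def split: if_splits)
  then obtain Q where Q1: "Q \<in> elementary_grading G I \<tau> \<one>" and fQ: "f Q = munit l l"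
    using graded[of \<one>] by (metis imageE one_closed)
  have Q: "Q \<in> ?M" using Q1 sub by auto
  have "Q \<noteq> 0"
  proof
    assume "Q = 0"
    then have "munit l l l l = (0::'f)"
      using fQ algebra_isomorphism_zero[OF f] by (metis zero_fun_apply)
    then show False by (simp add: munit_def)
  qed
  then obtain a m where am: "Q a m \<noteq> 0" by (metis ext zero_fun_apply)
  have aI: "a \<in> I" "m \<in> I" using Q am by (auto simp: finitary_matrices_def)
  then have c: "\<tau> a \<in> carrier G" "\<tau> m \<in> carrier G" using \<tau> by auto
  have "inv (\<tau> a) \<otimes> \<tau> m = \<one>" using Q1 am by (auto simp: elementary_grading_iff)
  \<comment> \<open>This equality is what makes the two translations, one for each direction,
    inverse to each other.\<close>
  then have \<tau>m: "\<tau> m = \<tau> a" using c by (metis inv_closed inv_equality inv_inv)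
  have Em: "munit m m \<in> ?M" using aI by (simp add: finitary_munit)
  have fEm: "f (munit m m) \<in> ?M" using bij Em by (auto simp: bij_betw_def)
  \<comment> \<open>If row \<open>l\<close> of \<open>f (munit m m)\<close> vanished, so would
    \<open>f (mmult Q (munit m m))\<close>, although column \<open>m\<close> of \<open>Q\<close> is
    nonzero.\<close>
  obtain n where n: "f (munit m m) l n \<noteq> 0"
  proof (rule ccontr)
    assume "\<not> thesis"
    with that have "f (munit m m) l n = 0" for n by blast
    then have "mmult (munit l l) (f (munit m m)) = 0" by (simp add: fun_eq_iff mmult_munit_left)
    then have "f (mmult Q (munit m m)) = f 0"
      using Q Em by (simp add: algebra_isomorphismD(4)[OF f] algebra_isomorphism_zero[OF f] fQ)
    then have "mmult Q (munit m m) = 0"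
      using bij finitary_mmult[OF Q Em] mat.subspace_0[OF subspace_finitary]
      by (auto simp: bij_betw_def dest: inj_onD)
    then have "mmult Q (munit m m) a m = 0" by simp
    with am show False by (simp add: mmult_munit_right)
  qed
  let ?g = "\<tau>' l \<otimes> inv (\<tau> a)"
  have g0: "?g \<in> carrier G" using tl c by auto
  have "fibre_card I \<tau> g = fibre_card I \<tau>' (?g \<otimes> g)" if g: "g \<in> carrier G" for g
  proof (rule antisym)
    show "fibre_card I \<tau> g \<le> fibre_card I \<tau>' (?g \<otimes> g)"
      using graded by (intro fibre_card_le[OF \<tau> \<tau>' f _ Q fQ am l g]) auto
  next
    have "?g \<otimes> g \<in> carrier G" using g0 g by auto
    then have "fibre_card I \<tau>' (?g \<otimes> g) \<le> fibre_card I \<tau> (\<tau> m \<otimes> inv (\<tau>' l) \<otimes> (?g \<otimes> g))"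
      \<comment> \<open>Here \<open>h\<close> replaces \<open>f\<close>,
        \<open>f (munit m m)\<close> replaces \<open>Q\<close>, \<open>m\<close> replaces
        \<open>l\<close>, and the nonzero entry is at \<open>(l, n)\<close>.\<close>
      using h_graded by (intro fibre_card_le[OF \<tau>' \<tau> h_iso _ fEm hf[OF Em] n aI(2)]) auto
    also have "\<tau> m \<otimes> inv (\<tau>' l) \<otimes> (?g \<otimes> g) = \<tau> m \<otimes> inv (\<tau>' l) \<otimes> ?g \<otimes> g"
      using g c tl by (simp add: m_assoc)
    also have "\<tau> m \<otimes> inv (\<tau>' l) \<otimes> ?g = \<one>"
    proof -
      have "\<tau> m \<otimes> inv (\<tau>' l) = inv ?g" using c tl by (simp add: \<tau>m inv_mult_group)
      then show ?thesis using g0 by simp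
    qed
    finally show "fibre_card I \<tau>' (?g \<otimes> g) \<le> fibre_card I \<tau> g" using g by simp
  qed
  with g0 show ?thesis by blast
qed

section \<open>From equal fibre sizes to a permutation of the indices\<close>

text \<open>Indices are naturals, so any two infinite fibres are countably infinite and hence in
  bijection; a single value \<infinity> loses no information.\<close>

lemma fibre_card_eq_imp_bij_betw:
  assumes "fibre_card I \<tau> g = fibre_card I \<tau>' g'"
  shows "\<exists>p. bij_betw p {i \<in> I. \<tau> i = g} {i \<in> I. \<tau>' i = g'}"
proof (cases "finite {i \<in> I. \<tau> i = g}")
  case True
  then have "finite {i \<in> I. \<tau>' i = g'}" "card {i \<in> I. \<tau> i = g} = card {i \<in> I. \<tau>' i = g'}"
    using assms by (auto simp: fibre_card_def split: if_splits)
  with True show ?thesis by (intro finite_same_card_bij)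
next
  case False
  then have "infinite {i \<in> I. \<tau>' i = g'}"
    using assms by (auto simp: fibre_card_def split: if_splits)
  with False show ?thesis
    by (meson bij_betw_from_nat_into bij_betw_inv_into bij_betw_trans
        countableI_type to_nat_on_infinite)
qed

text \<open>Entries are read through \<open>q\<close>, so for a permutation \<open>q\<close> of
  \<open>I\<close> the unit at \<open>(i, j)\<close> moves to the preimages of \<open>i\<close> and
  \<open>j\<close> in \<open>I\<close>. The cut-off is there because \<open>q\<close> is arbitrary
  outside \<open>I\<close>.\<close>

definition permute_matrix :: "nat set \<Rightarrow> (nat \<Rightarrow> nat) \<Rightarrow> 'f::field matrix \<Rightarrow> 'f matrix" where
  "permute_matrix I q A = (\<lambda>k l. if k \<in> I \<and> l \<in> I then A (q k) (q l) else 0)"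

lemma finitary_permute_matrix:
  assumes "bij_betw q I I" and A: "A \<in> finitary_matrices I"
  shows "permute_matrix I q A \<in> finitary_matrices I"
proof -
  let ?D = "{(k, l). permute_matrix I q A k l \<noteq> 0}"
  have D: "?D \<subseteq> I \<times> I" by (auto simp: permute_matrix_def split: if_splits)
  \<comment> \<open>The support of the permuted matrix embeds into that of \<open>A\<close>.\<close>
  have "map_prod q q ` ?D \<subseteq> {(i, j). A i j \<noteq> 0}"
    by (auto simp: permute_matrix_def split: if_splits)
  then have "finite (map_prod q q ` ?D)"
    using A by (auto simp: finitary_matrices_def intro: finite_subset)
  moreover have "inj_on (map_prod q q) ?D"
    using assms(1) D by (auto simp: bij_betw_def intro: inj_on_subset map_prod_inj_on)
  ultimately have "finite ?D" by (rule finite_imageD)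
  then show ?thesis by (auto simp: finitary_matrices_def permute_matrix_def split: if_splits)
qed

lemma permute_matrix_inverse:
  assumes A: "A \<in> finitary_matrices I" and "bij_betw q I I" "\<And>k. k \<in> I \<Longrightarrow> p (q k) = k"
  shows "permute_matrix I q (permute_matrix I p A) = A"
proof (intro ext)
  fix k l
  show "permute_matrix I q (permute_matrix I p A) k l = A k l"
    using assms bij_betw_apply[OF assms(2)]
    by (auto simp: permute_matrix_def finitary_matrices_def)
qed

text \<open>Serves the inner index of a matrix product. \<open>Sum_any\<close> runs over all
  naturals but \<open>q\<close> permutes only \<open>I\<close>, so the reindexed summand is set to
  zero outside \<open>I\<close>.\<close>

lemma Sum_any_reindex_bij_betw:
  assumes q: "bij_betw q I I" and F: "\<And>m. F m \<noteq> 0 \<Longrightarrow> m \<in> I"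
  shows "Sum_any F = Sum_any (\<lambda>n. if n \<in> I then F (q n) else 0)"
proof -
  let ?S = "{n. (if n \<in> I then F (q n) else 0) \<noteq> 0}"
  have "q ` ?S = {m. F m \<noteq> 0}"
    using q F by (fastforce simp: bij_betw_def split: if_splits)
  then have "bij_betw q ?S {m. F m \<noteq> 0}"
    using q by (auto simp: bij_betw_def split: if_splits intro: inj_on_subset)
  then have "sum F {m. F m \<noteq> 0} = (\<Sum>n\<in>?S. F (q n))"
    by (simp add: sum.reindex_bij_betw)
  also have "\<dots> = (\<Sum>n\<in>?S. if n \<in> I then F (q n) else 0)"
    by (rule sum.cong) (auto split: if_splits)
  finally show ?thesis by (simp add: Sum_any.expand_set)
qed

lemma permute_matrix_mmult:
  assumes q: "bij_betw q I I" and A: "A \<in> finitary_matrices I"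
  shows "permute_matrix I q (mmult A B) = mmult (permute_matrix I q A) (permute_matrix I q B)"
proof (intro ext)
  fix k l
  show "permute_matrix I q (mmult A B) k l = mmult (permute_matrix I q A) (permute_matrix I q B) k l"
  proof (cases "k \<in> I \<and> l \<in> I")
    case True
    \<comment> \<open>The factor from \<open>A\<close> vanishes for \<open>m\<close> outside
      \<open>I\<close>, and the cut-off produced by reindexing is the one built into
      \<open>permute_matrix\<close>.\<close>
    have "Sum_any (\<lambda>m. A (q k) m * B m (q l))
        = Sum_any (\<lambda>n. if n \<in> I then A (q k) (q n) * B (q n) (q l) else 0)"
      using A by (intro Sum_any_reindex_bij_betw[OF q]) (auto simp: finitary_matrices_def)
    also have "\<dots> = Sum_any (\<lambda>n. permute_matrix I q A k n * permute_matrix I q B n l)"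
      using True by (intro arg_cong[of _ _ Sum_any]) (auto simp: permute_matrix_def)
    finally show ?thesis using True by (simp add: mmult_def permute_matrix_def)
  qed (auto simp: mmult_def permute_matrix_def)
qed

lemma algebra_isomorphism_permute_matrix:
  assumes q: "bij_betw q I I"
  shows "algebra_isomorphism I (permute_matrix I q)"
  unfolding algebra_isomorphism_def
proof (intro conjI ballI allI)
  let ?p = "inv_into I q"
  have p: "bij_betw ?p I I" using q by (rule bij_betw_inv_into)
  show "bij_betw (permute_matrix I q) (finitary_matrices I) (finitary_matrices I)"
    using p q
    by (intro bij_betw_byWitness[where f' = "permute_matrix I ?p"])
      (auto intro!: permute_matrix_inverse finitary_permute_matrix
        simp: bij_betw_inv_into_left bij_betw_inv_into_right)
next
  fix A B :: "'a matrix" assume "A \<in> finitary_matrices I"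
  then show "permute_matrix I q (mmult A B) = mmult (permute_matrix I q A) (permute_matrix I q B)"
    by (rule permute_matrix_mmult[OF q])
qed (auto simp: fun_eq_iff permute_matrix_def mscale_def)

text \<open>Position \<open>(k, l)\<close> receives the entry at \<open>(q k, q l)\<close>, and
  \<open>deg\<close> says that both have the same degree. Applied to a permutation and to its
  inverse, this gives equality of components and not just an inclusion.\<close>

lemma permute_matrix_elementary_grading:
  assumes q: "bij_betw q I I"
    and deg: "\<And>k l. k \<in> I \<Longrightarrow> l \<in> I \<Longrightarrow>
      inv\<^bsub>G\<^esub> (\<tau>' k) \<otimes>\<^bsub>G\<^esub> \<tau>' l = inv\<^bsub>G\<^esub> (\<tau> (q k)) \<otimes>\<^bsub>G\<^esub> \<tau> (q l)"
    and A: "A \<in> elementary_grading G I \<tau> g"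
  shows "permute_matrix I q A \<in> elementary_grading G I \<tau>' g"
  unfolding elementary_grading_iff
proof (intro conjI allI impI)
  show "permute_matrix I q A \<in> finitary_matrices I"
    using A by (intro finitary_permute_matrix[OF q]) (simp add: elementary_grading_iff)
next
  fix k l assume "permute_matrix I q A k l \<noteq> 0"
  then have kl: "k \<in> I" "l \<in> I" "A (q k) (q l) \<noteq> 0"
    by (auto simp: permute_matrix_def split: if_splits)
  show "inv\<^bsub>G\<^esub> (\<tau>' k) \<otimes>\<^bsub>G\<^esub> \<tau>' l = g"
    unfolding deg[OF kl(1,2)] using A kl(3) by (simp add: elementary_grading_iff)
qed

lemma (in group) fibre_card_imp_graded_isomorphic:
  assumes \<tau>: "\<tau> \<in> I \<rightarrow> carrier G" and \<tau>': "\<tau>' \<in> I \<rightarrow> carrier G"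
    and g0: "g\<^sub>0 \<in> carrier G"
    and eq: "\<And>g. g \<in> carrier G \<Longrightarrow> fibre_card I \<tau> g = fibre_card I \<tau>' (g\<^sub>0 \<otimes> g)"
  shows "graded_isomorphic G I (elementary_grading G I \<tau> :: 'a \<Rightarrow> 'f::field matrix set)
      (elementary_grading G I \<tau>')"
proof -
  have "\<forall>g\<in>carrier G. \<exists>p. bij_betw p {i \<in> I. \<tau> i = g} {i \<in> I. \<tau>' i = g\<^sub>0 \<otimes> g}"
    using fibre_card_eq_imp_bij_betw[OF eq] by blast
  then obtain P where P:
    "\<And>g. g \<in> carrier G \<Longrightarrow> bij_betw (P g) {i \<in> I. \<tau> i = g} {i \<in> I. \<tau>' i = g\<^sub>0 \<otimes> g}"
    by metis
  \<comment> \<open>The fibre bijections are glued: they have disjoint domains, and their images are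
    disjoint because left translation by \<open>g\<^sub>0\<close> is injective.\<close>
  define p where "p i = P (\<tau> i) i" for i
  have p: "p i \<in> I" "\<tau>' (p i) = g\<^sub>0 \<otimes> \<tau> i" if "i \<in> I" for i
    using bij_betw_apply[OF P[of "\<tau> i"], of i] that \<tau> by (auto simp: p_def)
  have "inj_on p I"
  proof (rule inj_onI)
    fix i j assume ij: "i \<in> I" "j \<in> I" "p i = p j"
    have c: "\<tau> i \<in> carrier G" "\<tau> j \<in> carrier G" using ij \<tau> by auto
    have "g\<^sub>0 \<otimes> \<tau> i = g\<^sub>0 \<otimes> \<tau> j" using p(2) ij by metis
    then have "\<tau> i = \<tau> j" using c g0 by simp
    then show "i = j"
      using P[OF c(1)] ij by (auto simp: p_def bij_betw_def dest: inj_onD)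
  qed
  moreover have "I \<subseteq> p ` I"
  proof
    fix k assume k: "k \<in> I"
    \<comment> \<open>The only fibre of \<tau> whose image can contain \<open>k\<close>.\<close>
    define g where "g = inv g\<^sub>0 \<otimes> \<tau>' k"
    have g: "g \<in> carrier G" "g\<^sub>0 \<otimes> g = \<tau>' k"
      using k \<tau>' g0 by (auto simp: g_def m_assoc[symmetric] Pi_iff)
    then have "k \<in> P g ` {i \<in> I. \<tau> i = g}" using P[OF g(1)] k by (simp add: bij_betw_def)
    then show "k \<in> p ` I" by (auto simp: p_def)
  qed
  ultimately have bij: "bij_betw p I I" using p(1) by (auto simp: bij_betw_def)
  \<comment> \<open>Since \<open>permute_matrix\<close> reads entries backwards, moving units along
    \<open>p\<close> requires the inverse of \<open>p\<close>.\<close>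
  let ?q = "inv_into I p"
  have q: "bij_betw ?q I I" using bij by (rule bij_betw_inv_into)
  have pq: "p (?q k) = k" "?q k \<in> I" if "k \<in> I" for k
    using that bij bij_betw_apply[OF q] by (auto simp: bij_betw_inv_into_right)
  \<comment> \<open>The common left factor \<open>g\<^sub>0\<close> cancels in the degree of a
    unit.\<close>
  have deg: "inv (\<tau>' (p i)) \<otimes> \<tau>' (p j) = inv (\<tau> i) \<otimes> \<tau> j" if "i \<in> I" "j \<in> I" for i j
  proof -
    have c: "\<tau> i \<in> carrier G" "\<tau> j \<in> carrier G" using that \<tau> by auto
    then have "inv (g\<^sub>0 \<otimes> \<tau> i) \<otimes> (g\<^sub>0 \<otimes> \<tau> j) = inv (\<tau> i) \<otimes> (inv g\<^sub>0 \<otimes> (g\<^sub>0 \<otimes> \<tau> j))"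
      using g0 by (simp add: inv_mult_group m_assoc)
    also have "inv g\<^sub>0 \<otimes> (g\<^sub>0 \<otimes> \<tau> j) = \<tau> j"
      using g0 c by (simp add: m_assoc[symmetric])
    finally show ?thesis using that p(2) by simp
  qed
  have "permute_matrix I ?q ` elementary_grading G I \<tau> g
      = (elementary_grading G I \<tau>' g :: 'f matrix set)" for g
  proof
    show "permute_matrix I ?q ` elementary_grading G I \<tau> g
        \<subseteq> (elementary_grading G I \<tau>' g :: 'f matrix set)"
      using deg[OF pq(2) pq(2)] pq(1)
      by (auto intro!: permute_matrix_elementary_grading[OF q, where \<tau> = \<tau>])
  next
    show "(elementary_grading G I \<tau>' g :: 'f matrix set)
        \<subseteq> permute_matrix I ?q ` elementary_grading G I \<tau> g"
    proof
      fix B :: "'f matrix" assume B: "B \<in> elementary_grading G I \<tau>' g"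
      then have "permute_matrix I ?q (permute_matrix I p B) = B"
        using pq q by (intro permute_matrix_inverse) (auto simp: elementary_grading_iff)
      moreover have "permute_matrix I p B \<in> elementary_grading G I \<tau> g"
        using deg B by (intro permute_matrix_elementary_grading[OF bij, where \<tau> = \<tau>']) auto
      ultimately show "B \<in> permute_matrix I ?q ` elementary_grading G I \<tau> g"
        by (metis imageI)
    qed
  qed
  then show ?thesis
    unfolding graded_isomorphic_def using algebra_isomorphism_permute_matrix[OF q] by blast
qed

theorem theorem6:
  fixes G :: "('g, 'm) monoid_scheme"
    and I :: "nat set"
    and \<tau> \<tau>' :: "nat \<Rightarrow> 'g"
    and R R' :: "'g \<Rightarrow> 'f::field matrix set"
  assumes "group G"
    and "I = {1..} \<or> (\<exists>n\<ge>1. I = {1..n})"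
    and "\<tau> \<in> I \<rightarrow> carrier G"
    and "\<tau>' \<in> I \<rightarrow> carrier G"
    and "R = elementary_grading G I \<tau>"
    and "R' = elementary_grading G I \<tau>'"
  shows "graded_isomorphic G I R R' \<longleftrightarrow>
    (\<exists>g\<^sub>0\<in>carrier G. \<forall>g\<in>carrier G. fibre_card I \<tau> g = fibre_card I \<tau>' (g\<^sub>0 \<otimes>\<^bsub>G\<^esub> g))"
proof -
  interpret group G by fact
  \<comment> \<open>The forward direction needs some index \<open>l\<close> to start from.\<close>
  have "I \<noteq> {}" using assms(2) by auto
  then show ?thesis
    unfolding assms(5,6)
    using graded_isomorphic_imp_fibre_card[OF assms(3,4)]
      fibre_card_imp_graded_isomorphic[OF assms(3,4)]
    by blast
qed

end
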